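(* Let $d>1$. Any local algorithm $\hat V_0$ for the Euler characteristic $V_0$ (as defined in the context, for any $n\in\mathbb N$ and any lattice $\mathbb L\subseteq\mathbb R^d$) is asymptotically biased on $\mathcal P^d$; i.e. there is a $P\in\mathcal P^d$ for which it is not the case that $\lim_{a\to0}E\hat V_0^{a\mathbb L_c}(P)$ exists and equals $V_0(P)$. (Hence $\hat V_0$ is not multigrid convergent on $\mathcal P^d$.)
   Context: Lattice and configurations: $\xi=\{\xi_1,\dots,\xi_d\}$ is a positively oriented basis of $\mathbb R^d$, $\mathbb L$ is the lattice it spans, $C_\xi=\bigoplus_{i=1}^d[0,\xi_i]$ is its unit cell, and $\mathbb L_c=\mathbb L+c$ for $c\in\mathbb R^d$. For $n\in\mathbb N$ let $C^n_{0,0}=\{\sum_i\lambda_i\xi_i:\lambda_i\in\{0,\dots,n-1\}\}$. An $n\times\dots\times n$ configuration is a pair $(B,W)$ of disjoint sets with $B\cup W=C^n_{0,0}$; these are enumerated as $(B_l,W_l)$, $l=0,\dots,2^{n^d}-1$, with $B_0=\emptyset$ and $B_{2^{n^d}-1}=C^n_{0,0}$. Local algorithm for $V_q$ (here $q=0$): functions $w_l:(0,\infty)\to\mathbb R$ (weights), $l=1,\dots,2^{n^d}-1$, giving for compact $X\subseteq\mathbb R^d$, $a>0$, $c\in C_\xi$ the estimator $\hat V_q^{a\mathbb L_c}(X)=\sum_{l=1}^{2^{n^d}-1}w_l(a)N_l(X\cap a\mathbb L_c)$, where $N_l(X\cap a\mathbb L_c)$ is the number of $z\in\mathbb L$ with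 $a(z+c)+aB_l\subseteq X$ and $a(z+c)+aW_l\subseteq\mathbb R^d\setminus X$. The weights are motion and reflection invariant: $w_{l_1}=w_{l_2}$ whenever there are a rotation or reflection $R$ preserving $\mathbb L$ and $z_1,z_2\in\mathbb R^d$ with $R(B_{l_1}+z_1)=B_{l_2}+z_2$. $V_0$ is the Euler characteristic, so $V_0(P)=1$ for non-empty compact convex $P$. $\mathcal P^d$ is the set of compact convex polytopes in $\mathbb R^d$ with non-empty interior. $E$ denotes the mean when $c$ is uniformly distributed in $C_\xi$. The algorithm is multigrid convergent on a class $\mathcal S$ if $\lim_{a\to0}\hat V_0^{a\mathbb L_0}(X)=V_0(X)$ for all $X\in\mathcal S$. *)

theory Defs
  imports "HOL-Analysis.Analysis" "HOL-Homology.Homology"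
begin

text \<open>
  The sign of the determinant does not depend on an ordering of the index type: the same
  index type labels both the basis vectors and the coordinates.
\<close>
definition positively_oriented_basis :: "('d::finite \<Rightarrow> real^'d) \<Rightarrow> bool" where
  "positively_oriented_basis \<xi> \<longleftrightarrow>
     inj \<xi> \<and> independent (range \<xi>) \<and> span (range \<xi>) = UNIV \<and> det (\<chi> i j. \<xi> j $ i) > 0"

definition spanned_lattice :: "('d::finite \<Rightarrow> real^'d) \<Rightarrow> (real^'d) set" where
  "spanned_lattice \<xi> = {(\<Sum>i\<in>UNIV. of_int (k i) *\<^sub>R \<xi> i) | k :: 'd \<Rightarrow> int. True}"

definition unit_cell :: "('d::finite \<Rightarrow> real^'d) \<Rightarrow> (real^'d) set" where
  "unit_cell \<xi> = {(\<Sum>i\<in>UNIV. t i *\<^sub>R \<xi> i) | t :: 'd \<Rightarrow> real. \<forall>i. 0 \<le> t i \<and> t i \<le> 1}"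

definition grid_block :: "('d::finite \<Rightarrow> real^'d) \<Rightarrow> nat \<Rightarrow> (real^'d) set" where
  "grid_block \<xi> n = {(\<Sum>i\<in>UNIV. of_nat (k i) *\<^sub>R \<xi> i) | k :: 'd \<Rightarrow> nat. \<forall>i. k i < n}"

definition configurations ::
    "('d::finite \<Rightarrow> real^'d) \<Rightarrow> nat \<Rightarrow> ((real^'d) set \<times> (real^'d) set) set" where
  "configurations \<xi> n = {(B, W). B \<inter> W = {} \<and> B \<union> W = grid_block \<xi> n}"

definition configuration_enumeration ::
    "('d::finite \<Rightarrow> real^'d) \<Rightarrow> nat \<Rightarrow> (nat \<Rightarrow> (real^'d) set) \<Rightarrow> (nat \<Rightarrow> (real^'d) set) \<Rightarrow> bool" where
  "configuration_enumeration \<xi> n B W \<longleftrightarrow>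
     bij_betw (\<lambda>l. (B l, W l)) {0..2 ^ (n ^ CARD('d)) - 1} (configurations \<xi> n) \<and>
     B 0 = {} \<and> B (2 ^ (n ^ CARD('d)) - 1) = grid_block \<xi> n"

definition hit_or_miss_count ::
    "('d::finite \<Rightarrow> real^'d) \<Rightarrow> real \<Rightarrow> real^'d \<Rightarrow> (real^'d) set \<Rightarrow> (real^'d) set \<Rightarrow> (real^'d) set \<Rightarrow> nat" where
  "hit_or_miss_count \<xi> a c B W X =
     card {z \<in> spanned_lattice \<xi>.
             (\<lambda>b. a *\<^sub>R (z + c) + a *\<^sub>R b) ` B \<subseteq> X \<and> (\<lambda>b. a *\<^sub>R (z + c) + a *\<^sub>R b) ` W \<subseteq> - X}"

definition local_estimator ::
    "('d::finite \<Rightarrow> real^'d) \<Rightarrow> nat \<Rightarrow> (nat \<Rightarrow> (real^'d) set) \<Rightarrow> (nat \<Rightarrow> (real^'d) set) \<Rightarrow>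
     (nat \<Rightarrow> real \<Rightarrow> real) \<Rightarrow> real \<Rightarrow> real^'d \<Rightarrow> (real^'d) set \<Rightarrow> real" where
  "local_estimator \<xi> n B W w a c X =
     (\<Sum>l = 1..2 ^ (n ^ CARD('d)) - 1. w l a * of_nat (hit_or_miss_count \<xi> a c (B l) (W l) X))"

definition mean_local_estimator ::
    "('d::finite \<Rightarrow> real^'d) \<Rightarrow> nat \<Rightarrow> (nat \<Rightarrow> (real^'d) set) \<Rightarrow> (nat \<Rightarrow> (real^'d) set) \<Rightarrow>
     (nat \<Rightarrow> real \<Rightarrow> real) \<Rightarrow> real \<Rightarrow> (real^'d) set \<Rightarrow> real" where
  "mean_local_estimator \<xi> n B W w a X =
     integral\<^sup>L (uniform_measure lborel (unit_cell \<xi>)) (\<lambda>c. local_estimator \<xi> n B W w a c X)"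

text \<open>Linear; rotations about, and reflections in, other points or affine hyperplanes are
  covered by the translations in the invariance condition below.\<close>
definition is_rotation :: "(real^'d::finite \<Rightarrow> real^'d) \<Rightarrow> bool" where
  "is_rotation R \<longleftrightarrow> orthogonal_transformation R \<and> det (matrix R) = 1"

definition is_reflection :: "(real^'d::finite \<Rightarrow> real^'d) \<Rightarrow> bool" where
  "is_reflection R \<longleftrightarrow> (\<exists>v. v \<noteq> 0 \<and> R = (\<lambda>x. x - (2 * (x \<bullet> v) / (v \<bullet> v)) *\<^sub>R v))"

text \<open>Weights are functions on the positive reals, so they are only compared there.\<close>
definition motion_reflection_invariant ::
    "('d::finite \<Rightarrow> real^'d) \<Rightarrow> nat \<Rightarrow> (nat \<Rightarrow> (real^'d) set) \<Rightarrow> (nat \<Rightarrow> real \<Rightarrow> real) \<Rightarrow> bool" where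
  "motion_reflection_invariant \<xi> n B w \<longleftrightarrow>
     (\<forall>l1 \<in> {1..2 ^ (n ^ CARD('d)) - 1}. \<forall>l2 \<in> {1..2 ^ (n ^ CARD('d)) - 1}. \<forall>R z1 z2.
        (is_rotation R \<or> is_reflection R) \<and> R ` spanned_lattice \<xi> = spanned_lattice \<xi> \<and>
        R ` ((\<lambda>x. x + z1) ` B l1) = (\<lambda>x. x + z2) ` B l2
        \<longrightarrow> (\<forall>a>0. w l1 a = w l2 a))"

definition int_independent :: "('g, 'b) monoid_scheme \<Rightarrow> 'g set \<Rightarrow> bool" where
  "int_independent G S \<longleftrightarrow> S \<subseteq> carrier G \<and>
     (\<forall>F (k :: 'g \<Rightarrow> int). finite F \<and> F \<subseteq> S \<and> finprod G (\<lambda>x. x [^]\<^bsub>G\<^esub> k x) F = \<one>\<^bsub>G\<^esub>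
        \<longrightarrow> (\<forall>x\<in>F. k x = 0))"

text \<open>Meaningful for abelian groups of finite rank only.\<close>
definition abelian_rank :: "('g, 'b) monoid_scheme \<Rightarrow> nat" where
  "abelian_rank G = Max (card ` {S. finite S \<and> int_independent G S})"

definition betti_number :: "nat \<Rightarrow> 'a::topological_space set \<Rightarrow> nat" where
  "betti_number p X = abelian_rank (homology_group (int p) (top_of_set X))"

text \<open>The alternating sum of the ranks of the integral singular homology groups, for sets
  with finitely many non-zero, finite Betti numbers.\<close>
definition euler_characteristic :: "'a::topological_space set \<Rightarrow> real" where
  "euler_characteristic X = (\<Sum>p | betti_number p X \<noteq> 0. (- 1) ^ p * of_nat (betti_number p X))"

definition convex_polytopes :: "(real^'d::finite) set set" where
  "convex_polytopes = {P. polytope P \<and> interior P \<noteq> {}}"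

definition multigrid_convergent ::
    "('d::finite \<Rightarrow> real^'d) \<Rightarrow> nat \<Rightarrow> (nat \<Rightarrow> (real^'d) set) \<Rightarrow> (nat \<Rightarrow> (real^'d) set) \<Rightarrow>
     (nat \<Rightarrow> real \<Rightarrow> real) \<Rightarrow> (real^'d) set set \<Rightarrow> bool" where
  "multigrid_convergent \<xi> n B W w \<S> \<longleftrightarrow>
     (\<forall>X\<in>\<S>. tendsto (\<lambda>a. local_estimator \<xi> n B W w a 0 X) (euler_characteristic X) (at_right 0))"

lemma abelian_rank_trivial:
  assumes "comm_group G" "trivial_group G" shows "abelian_rank G = 0"
proof -
  interpret comm_group G by fact
  have c: "carrier G = {\<one>\<^bsub>G\<^esub>}" using assms(2) by (simp add: trivial_group_def)
  have indep_iff: "int_independent G S \<longleftrightarrow> S = {}" for S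
  proof
    assume S: "int_independent G S"
    have "S \<subseteq> {\<one>\<^bsub>G\<^esub>}"
      using S unfolding int_independent_def c by (rule conjunct1)
    then have fin: "finite S" by (rule finite_subset) simp
    have prod: "finprod G (\<lambda>x. x [^]\<^bsub>G\<^esub> (1::int)) S = \<one>\<^bsub>G\<^esub>"
    proof (rule finprod_one_eqI)
      fix x assume "x \<in> S"
      with \<open>S \<subseteq> {\<one>\<^bsub>G\<^esub>}\<close> have "x = \<one>\<^bsub>G\<^esub>" by (metis singletonD subsetD)
      then show "x [^]\<^bsub>G\<^esub> (1::int) = \<one>\<^bsub>G\<^esub>" by (simp only: int_pow_one)
    qed
    have "finite S \<and> S \<subseteq> S \<and> finprod G (\<lambda>x. x [^]\<^bsub>G\<^esub> (1::int)) S = \<one>\<^bsub>G\<^esub> \<longrightarrow>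
        (\<forall>x\<in>S. (1::int) = 0)"
      using S[unfolded int_independent_def, THEN conjunct2, THEN spec, THEN spec, of S "\<lambda>_. 1"] .
    with fin prod have "\<forall>x\<in>S. (1::int) = 0" by blast
    then show "S = {}" by (metis equals0I zero_neq_one)
  next
    assume "S = {}"
    then show "int_independent G S" by (simp add: int_independent_def)
  qed
  have "{S. finite S \<and> int_independent G S} = {{}}"
    unfolding indep_iff by blast
  then show ?thesis unfolding abelian_rank_def by simp
qed

lemma abelian_rank_Z:
  assumes "comm_group G" "G \<cong> integer_group" shows "abelian_rank G = 1"
proof -
  interpret comm_group G by fact
  obtain h where h: "h \<in> iso G integer_group" using assms(2) unfolding is_iso_def by auto
  then have bij: "bij_betw h (carrier G) UNIV" and hom: "h \<in> hom G integer_group" by (auto simp: iso_def)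
  have hp: "h (x [^]\<^bsub>G\<^esub> (k::int)) = k * h x" if "x \<in> carrier G" for x k
    using group_hom.hom_int_pow[of G integer_group h x k] hom that by (simp add: group_hom_def group_hom_axioms_def is_group)
  have hm: "h (x \<otimes>\<^bsub>G\<^esub> y) = h x + h y" if "x \<in> carrier G" "y \<in> carrier G" for x y
    using hom that by (simp add: hom_def)
  have inj: "inj_on h (carrier G)" using bij by (simp add: bij_betw_def)
  have h1: "h \<one>\<^bsub>G\<^esub> = 0" using hp[of "\<one>\<^bsub>G\<^esub>" 0] by simp
  have le: "card S \<le> 1" if S: "int_independent G S" "finite S" for S
  proof (rule ccontr)
    assume "\<not> card S \<le> 1"
    then obtain x y where xy: "x \<in> S" "y \<in> S" "x \<noteq> y"
      using card_le_Suc0_iff_eq[OF S(2)] by auto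
    then have c: "x \<in> carrier G" "y \<in> carrier G" using S by (auto simp: int_independent_def)
    define k where "k = (\<lambda>z. if z = x then h y else - h x)"
    have "finprod G (\<lambda>x. x [^]\<^bsub>G\<^esub> k x) {x,y} = x [^]\<^bsub>G\<^esub> k x \<otimes>\<^bsub>G\<^esub> y [^]\<^bsub>G\<^esub> k y"
      using xy c by (subst finprod_insert) auto
    also have "\<dots> = \<one>\<^bsub>G\<^esub>"
    proof (rule inj_onD[OF inj])
      have "h (x [^]\<^bsub>G\<^esub> k x \<otimes>\<^bsub>G\<^esub> y [^]\<^bsub>G\<^esub> k y) = k x * h x + k y * h y"
        using c by (simp only: hm hp int_pow_closed)
      then show "h (x [^]\<^bsub>G\<^esub> k x \<otimes>\<^bsub>G\<^esub> y [^]\<^bsub>G\<^esub> k y) = h \<one>\<^bsub>G\<^esub>"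
        using xy by (simp add: h1 k_def)
    qed (use c in simp_all)
    finally have eq: "finprod G (\<lambda>x. x [^]\<^bsub>G\<^esub> k x) {x,y} = \<one>\<^bsub>G\<^esub>" .
    have "\<forall>z\<in>{x,y}. k z = 0"
      using S(1)[unfolded int_independent_def, THEN conjunct2, rule_format, of "{x,y}" k] eq xy(1,2)
      by simp
    then have "h y = 0" "h x = 0" using xy by (auto simp: k_def)
    then show False using inj_onD[OF inj _ c] xy(3) by simp
  qed
  obtain g where g: "g \<in> carrier G" "h g = 1" using bij by (metis UNIV_I bij_betw_def imageE)
  have gi: "int_independent G {g}"
    unfolding int_independent_def
  proof (intro conjI allI impI)
    show "{g} \<subseteq> carrier G" using g by simp
  next
    fix F and k :: "'a \<Rightarrow> int"
    assume F: "finite F \<and> F \<subseteq> {g} \<and> finprod G (\<lambda>x. x [^]\<^bsub>G\<^esub> k x) F = \<one>\<^bsub>G\<^esub>"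
    show "\<forall>x\<in>F. k x = 0"
    proof (cases "F = {}")
      case False
      then have "F = {g}" using F by auto
      then have "g [^]\<^bsub>G\<^esub> k g = \<one>\<^bsub>G\<^esub>" using F g by simp
      then have "k g * h g = 0" using hp[OF g(1), of "k g"] h1 by simp
      then show ?thesis using g \<open>F = {g}\<close> by simp
    qed simp
  qed
  have sub: "card ` {S. finite S \<and> int_independent G S} \<subseteq> {..1}" using le by auto
  have mem: "1 \<in> card ` {S. finite S \<and> int_independent G S}" by (rule image_eqI[of _ _ "{g}"]) (simp_all add: gi)
  show ?thesis unfolding abelian_rank_def
  proof (rule Max_eqI)
    show "finite (card ` {S. finite S \<and> int_independent G S})"
      by (rule finite_subset[OF sub]) simp
    show "y \<le> 1" if "y \<in> card ` {S. finite S \<and> int_independent G S}" for y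
      using subsetD[OF sub that] by simp
  qed (rule mem)
qed

lemma euler_characteristic_convex:
  fixes X :: "'a::real_normed_vector set"
  assumes "convex X" "X \<noteq> {}"
  shows "euler_characteristic X = 1"
proof -
  have con: "contractible_space (top_of_set X)" using assms convex_imp_contractible by (simp add: contractible_space_top_of_set)
  have b0: "betti_number 0 X = 1" unfolding betti_number_def
    using con assms abelian_rank_Z[OF abelian_homology_group isomorphic_integer_zeroth_homology_group[OF contractible_imp_path_connected_space[OF con]]] by simp
  have bp: "betti_number p X = 0" if "p \<noteq> 0" for p unfolding betti_number_def
    using abelian_rank_trivial[OF abelian_homology_group, of "int p" "top_of_set X"] trivial_reduced_homology_group_contractible_space[OF con, of "int p"] that by (simp add: un_reduced_homology_group)
  have "{p. betti_number p X \<noteq> 0} = {0}"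
  proof (rule Set.set_eqI)
    show "p \<in> {p. betti_number p X \<noteq> 0} \<longleftrightarrow> p \<in> {0}" for p
      using b0 bp[of p] by (cases "p = 0") simp_all
  qed
  then show ?thesis unfolding euler_characteristic_def by (simp add: b0)
qed

end

theory Submission
  imports Defs
begin

text \<open>
  There are three parallelotopes whose hit-or-miss counts satisfy a linear relation that their
  Euler characteristics violate. It comes from the linear dependence of the counts on a facet
  normal that varies in a suitable cone and may lie on either side of another facet normal.

  Let \<open>f\<^sub>1, \<dots>, f\<^sub>d\<close> be linear functionals that form a basis of the dual lattice, and let
  \<open>P\<close> be a parallelotope given by \<open>1/2 \<le> f\<^sub>i x \<le> L\<^sub>i + 1/2\<close> with integers \<open>L\<^sub>i\<close>. In the
  coordinates \<open>f\<^sub>i\<close> the lattice is the set of integer vectors and \<open>P\<close> is an axis-parallel box.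
  For a finite non-empty set \<open>S\<close> of lattice points and mesh \<open>1/m\<close> with \<open>m\<close> large, the number of lattice
  positions at which \<open>S\<close> hits \<open>P\<close> completely is therefore the product of the numbers
  \<open>m L\<^sub>i - extent S f\<^sub>i\<close>, for every position of the lattice that puts no lattice point on the
  hyperplanes bounding \<open>P\<close> (lemma \<open>hit_count_half_shifted_box\<close>).

  Keep all functionals but one, and call the remaining one \<open>g\<close>, with edge length \<open>L\<close>. The count
  is affine in the extent of \<open>S\<close> in direction \<open>g\<close>. If \<open>x\<close> and \<open>y\<close> are two lattice coordinates
  and \<open>g = \<alpha> x + \<beta> y\<close> with \<open>\<alpha>\<close> large compared to \<open>\<beta>\<close>, then the maximum and the minimum of \<open>g\<close>
  on \<open>S\<close> are attained at the lexicographically last and first points of \<open>S\<close>, whatever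
  \<open>(\<alpha>, \<beta>)\<close> is, so the extent is linear in \<open>(\<alpha>, \<beta>)\<close> (lemma \<open>extent_linear_on_cone\<close>).
  Choosing \<open>L\<close> linear in \<open>(\<alpha>, \<beta>)\<close> as well, namely \<open>L = \<beta>\<close>, every linear dependence between
  vectors \<open>(\<alpha>, \<beta>)\<close> turns into a linear dependence between counts
  (lemma \<open>hit_count_relation\<close>). Let \<open>u = (M, 1)\<close> with \<open>M\<close> large be the vector of one of the
  functionals that are kept, and \<open>v = (1, 0)\<close>. Each of \<open>u + v\<close>, \<open>u - v\<close> and \<open>2 u + v\<close> forms a
  lattice basis together with \<open>u\<close>, although they lie on different sides of \<open>u\<close>, and
  \[ 3 (u + v) + (u - v) = 2 (2 u + v). \]
  So the counts of the three parallelotopes \<open>P\<^sub>1, P\<^sub>2, P\<^sub>3\<close> satisfy \<open>3 N\<^sub>1 + N\<^sub>2 - 2 N\<^sub>3 = 0\<close>. By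
  inclusion-exclusion this passes from sets \<open>S\<close> to all configurations with at least one
  black point, hence to the estimators, which are linear combinations of their counts with
  weights that do not depend on the polytope, while the Euler characteristics give \<open>3 + 1 - 2 = 2\<close>.

  The boundary offset \<open>1/2\<close> makes the unshifted lattice admissible for every odd \<open>m\<close>. Since
  almost all shifts are admissible and the count is the same for all of them, the mean coincides
  with the value at the unshifted lattice, and the same three polytopes refute asymptotic
  unbiasedness and multigrid convergence.
\<close>

section \<open>Extents\<close>

definition extent :: "'a set \<Rightarrow> ('a \<Rightarrow> real) \<Rightarrow> real" where
  "extent S f = Max (f ` S) - Min (f ` S)"

lemma extent_cong: "(\<And>x. x \<in> S \<Longrightarrow> f x = g x) \<Longrightarrow> extent S f = extent S g"
  unfolding extent_def by (simp cong: image_cong)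

lemma extent_eqI:
  assumes "finite S" "s \<in> S" "t \<in> S" "\<And>x. x \<in> S \<Longrightarrow> f s \<le> f x" "\<And>x. x \<in> S \<Longrightarrow> f x \<le> f t"
  shows "extent S f = f t - f s"
proof -
  have "Max (f ` S) = f t" using assms by (intro Max_eqI) auto
  moreover have "Min (f ` S) = f s" using assms by (intro Min_eqI) auto
  ultimately show ?thesis by (simp add: extent_def)
qed

lemma extent_mono:
  assumes "finite T" "S \<subseteq> T" "S \<noteq> {}"
  shows "extent S f \<le> extent T f"
proof -
  have "Max (f ` S) \<le> Max (f ` T)" "Min (f ` T) \<le> Min (f ` S)"
    using assms by (auto intro!: Max_mono Min_antimono)
  then show ?thesis by (simp add: extent_def)
qed

text \<open>
  Any maximizer of \<open>N f + g\<close> works: since \<open>g\<close> takes values in \<open>{0..<N}\<close>, it is the maximizer in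
  the lexicographic order of \<open>(f, g)\<close>, and for \<open>N \<beta> \<le> \<alpha>\<close> no difference in \<open>g\<close> can outweigh a
  difference in \<open>f\<close>.
\<close>
lemma exists_uniform_maximizer:
  fixes f g :: "'a \<Rightarrow> int"
  assumes "finite S" "S \<noteq> {}"
    and g: "\<And>x. x \<in> S \<Longrightarrow> 0 \<le> g x \<and> g x < N"
  shows "\<exists>t\<in>S. \<forall>\<alpha> \<beta>. 0 \<le> \<beta> \<and> N * \<beta> \<le> \<alpha> \<longrightarrow>
    (\<forall>x\<in>S. \<alpha> * f x + \<beta> * g x \<le> \<alpha> * f t + \<beta> * g t)"
proof -
  have "Max ((\<lambda>x. N * f x + g x) ` S) \<in> (\<lambda>x. N * f x + g x) ` S"
    using assms(1,2) by (intro Max_in) auto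
  then obtain t where t: "t \<in> S" "Max ((\<lambda>x. N * f x + g x) ` S) = N * f t + g t" by blast
  have max: "N * f x + g x \<le> N * f t + g t" if "x \<in> S" for x
    unfolding t(2)[symmetric] using assms(1) that by (intro Max_ge) auto
  show ?thesis
  proof (intro bexI[OF _ t(1)] allI impI ballI)
    fix \<alpha> \<beta> x assume "0 \<le> \<beta> \<and> N * \<beta> \<le> \<alpha>" and x: "x \<in> S"
    then have b: "0 \<le> \<beta>" "N * \<beta> \<le> \<alpha>" by simp_all
    have N: "N > 0" using g[OF x] by linarith
    have "N * (f t - f x) \<ge> g x - g t" using max[OF x] by (simp add: algebra_simps)
    then have "N * (f t - f x) > N * (- 1)" using g[OF x] g[OF t(1)] by linarith
    then have D: "f t - f x \<ge> 0" using N by (simp only: mult_less_cancel_left_pos)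
    have "\<beta> * (g x - g t) \<le> \<beta> * (N * (f t - f x))"
      using max[OF x] b(1) by (intro mult_left_mono) (simp_all add: algebra_simps)
    also have "\<dots> = (N * \<beta>) * (f t - f x)" by simp
    also have "\<dots> \<le> \<alpha> * (f t - f x)" using b(2) D by (rule mult_right_mono)
    finally show "\<alpha> * f x + \<beta> * g x \<le> \<alpha> * f t + \<beta> * g t" by (simp add: algebra_simps)
  qed
qed

text \<open>
  Both end points of the range of \<open>\<alpha> f + \<beta> g\<close> are attained at points that do not depend on
  \<open>(\<alpha>, \<beta>)\<close>.
\<close>
lemma extent_linear_on_cone:
  fixes f g :: "'a \<Rightarrow> int"
  assumes "finite S" "S \<noteq> {}"
    and g: "\<And>x. x \<in> S \<Longrightarrow> 0 \<le> g x \<and> g x < N"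
  shows "\<exists>u v. \<forall>\<alpha> \<beta>. 0 \<le> \<beta> \<and> N * \<beta> \<le> \<alpha> \<longrightarrow>
    extent S (\<lambda>x. of_int (\<alpha> * f x + \<beta> * g x)) = of_int \<alpha> * u + of_int \<beta> * v"
proof -
  obtain t where t: "t \<in> S"
    "\<And>\<alpha> \<beta> x. \<lbrakk>0 \<le> \<beta>; N * \<beta> \<le> \<alpha>; x \<in> S\<rbrakk> \<Longrightarrow> \<alpha> * f x + \<beta> * g x \<le> \<alpha> * f t + \<beta> * g t"
    using exists_uniform_maximizer[OF assms(1,2) g, where f=f] by meson
  \<comment> \<open>The minimizer is the maximizer for the reflected pair \<open>(- f, N - 1 - g)\<close>.\<close>
  have g': "0 \<le> N - 1 - g x \<and> N - 1 - g x < N" if "x \<in> S" for x using g[OF that] by simp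
  obtain s where s: "s \<in> S"
    "\<And>\<alpha> \<beta> x. \<lbrakk>0 \<le> \<beta>; N * \<beta> \<le> \<alpha>; x \<in> S\<rbrakk>
       \<Longrightarrow> \<alpha> * (- f x) + \<beta> * (N - 1 - g x) \<le> \<alpha> * (- f s) + \<beta> * (N - 1 - g s)"
    using exists_uniform_maximizer[OF assms(1,2) g', where f="\<lambda>x. - f x"] by meson
  show ?thesis
  proof (intro exI allI impI)
    fix \<alpha> \<beta> :: int assume "0 \<le> \<beta> \<and> N * \<beta> \<le> \<alpha>"
    then have b: "0 \<le> \<beta>" "N * \<beta> \<le> \<alpha>" by simp_all
    have "\<alpha> * f s + \<beta> * g s \<le> \<alpha> * f x + \<beta> * g x" if "x \<in> S" for x
      using s(2)[OF b that] by (simp add: algebra_simps)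
    then have "extent S (\<lambda>x. of_int (\<alpha> * f x + \<beta> * g x))
        = of_int (\<alpha> * f t + \<beta> * g t) - of_int (\<alpha> * f s + \<beta> * g s)"
      using t(2)[OF b] s(1) t(1) assms(1) by (intro extent_eqI) (simp_all only: of_int_le_iff)
    then show "extent S (\<lambda>x. of_int (\<alpha> * f x + \<beta> * g x))
        = of_int \<alpha> * of_int (f t - f s) + of_int \<beta> * of_int (g t - g s)"
      by (simp add: algebra_simps)
  qed
qed

section \<open>Lattice charts\<close>

definition lattice_chart :: "('d::finite \<Rightarrow> real^'d) \<Rightarrow> (real^'d \<Rightarrow> real^'d) \<Rightarrow> bool" where
  "lattice_chart \<xi> Y \<longleftrightarrow> linear Y \<and> bij Y \<and> Y ` spanned_lattice \<xi> = {y. \<forall>i. y $ i \<in> \<int>}"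

lemma lattice_chart_Ints:
  "\<lbrakk>lattice_chart \<xi> Y; z \<in> spanned_lattice \<xi>\<rbrakk> \<Longrightarrow> Y z $ i \<in> \<int>"
  unfolding lattice_chart_def by blast

definition basis_matrix :: "('d::finite \<Rightarrow> real^'d) \<Rightarrow> real^'d^'d" where
  "basis_matrix \<xi> = (\<chi> i j. \<xi> j $ i)"

lemma basis_matrix_mult: "basis_matrix \<xi> *v x = (\<Sum>i\<in>UNIV. x $ i *\<^sub>R \<xi> i)"
  by (simp add: basis_matrix_def matrix_mult_sum column_def scalar_mult_eq_scaleR)

lemma coordinate_chart:
  assumes "positively_oriented_basis \<xi>"
  obtains \<Phi> where "lattice_chart \<xi> \<Phi>"
    "\<forall>x\<in>grid_block \<xi> n. \<forall>i. \<exists>k<n. \<Phi> x $ i = real k"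
proof -
  define A where "A = basis_matrix \<xi>"
  have "det A \<noteq> 0" using assms by (simp add: positively_oriented_basis_def A_def basis_matrix_def)
  then have "invertible A" by (simp add: invertible_det_nz)
  then obtain A' where A': "A' ** A = mat 1" "A ** A' = mat 1"
    by (auto simp: invertible_def)
  define \<Phi> where "\<Phi> = (*v) A'"
  have A: "A *v x = (\<Sum>i\<in>UNIV. x $ i *\<^sub>R \<xi> i)" for x
    by (simp add: A_def basis_matrix_mult)
  have \<Phi>A: "\<Phi> (A *v x) = x" and A\<Phi>: "A *v \<Phi> x = x" for x
    by (simp_all add: \<Phi>_def matrix_vector_mul_assoc A')
  have sum: "\<Phi> (\<Sum>i\<in>UNIV. k i *\<^sub>R \<xi> i) = (\<chi> i. k i)" for k
    using \<Phi>A[of "\<chi> i. k i"] by (simp add: A)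
  show thesis
  proof
    have "bij \<Phi>" using \<Phi>A A\<Phi> by (metis bijI')
    moreover have "\<Phi> ` spanned_lattice \<xi> = {y. \<forall>i. y $ i \<in> \<int>}"
    proof (intro equalityI subsetI)
      fix y assume "y \<in> \<Phi> ` spanned_lattice \<xi>"
      then show "y \<in> {y. \<forall>i. y $ i \<in> \<int>}" by (auto simp: spanned_lattice_def sum)
    next
      fix y :: "real^'a" assume "y \<in> {y. \<forall>i. y $ i \<in> \<int>}"
      then have y: "y $ i = of_int \<lfloor>y $ i\<rfloor>" for i by (simp add: of_int_floor)
      then have "y = \<Phi> (\<Sum>i\<in>UNIV. of_int \<lfloor>y $ i\<rfloor> *\<^sub>R \<xi> i)"
        unfolding sum by (simp add: vec_eq_iff)
      then show "y \<in> \<Phi> ` spanned_lattice \<xi>"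
        by (intro image_eqI) (auto simp: spanned_lattice_def)
    qed
    ultimately show "lattice_chart \<xi> \<Phi>" by (simp add: lattice_chart_def \<Phi>_def)
    show "\<forall>x\<in>grid_block \<xi> n. \<forall>i. \<exists>k<n. \<Phi> x $ i = real k"
      by (auto simp: grid_block_def sum)
  qed
qed

lemma finite_grid_block: "finite (grid_block \<xi> n)"
proof -
  have "grid_block \<xi> n \<subseteq> (\<lambda>k. \<Sum>i\<in>UNIV. of_nat (k i) *\<^sub>R \<xi> i) ` (PiE UNIV (\<lambda>_. {..<n}))"
    by (auto simp: grid_block_def PiE_UNIV_domain)
  then show ?thesis by (rule finite_subset) (simp add: finite_PiE)
qed

lemma grid_block_subset_lattice: "grid_block \<xi> n \<subseteq> spanned_lattice \<xi>"
proof
  fix x assume "x \<in> grid_block \<xi> n"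
  then obtain k :: "'a \<Rightarrow> nat" where "x = (\<Sum>i\<in>UNIV. of_int (int (k i)) *\<^sub>R \<xi> i)"
    by (auto simp: grid_block_def)
  then show "x \<in> spanned_lattice \<xi>"
    unfolding spanned_lattice_def by (intro CollectI exI[of _ "\<lambda>i. int (k i)"]) simp
qed

text \<open>
  The charts of the parallelotopes to be compared: they differ in the coordinate \<open>q\<close> only, whose
  functional lies in the same plane of the dual space as that of the coordinate \<open>p\<close>, so that it
  can pass from one side of the latter to the other.
\<close>
definition plane_chart ::
    "(real^'d::finite \<Rightarrow> real^'d) \<Rightarrow> 'd \<Rightarrow> 'd \<Rightarrow> int \<Rightarrow> int \<Rightarrow> int \<Rightarrow> real^'d \<Rightarrow> real^'d" where
  "plane_chart \<Phi> p q M \<alpha> \<beta> x =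
     (\<chi> i. if i = p then of_int M * \<Phi> x $ p + \<Phi> x $ q
           else if i = q then of_int \<alpha> * \<Phi> x $ p + of_int \<beta> * \<Phi> x $ q
           else \<Phi> x $ i)"

text \<open>
  The change of coordinates is an integer matrix with determinant \<open>M \<beta> - \<alpha>\<close>, so it preserves
  the integer vectors when this is \<open>1\<close> or \<open>- 1\<close>.
\<close>
lemma lattice_chart_plane_chart:
  assumes \<Phi>: "lattice_chart \<xi> \<Phi>" and "p \<noteq> q" and "\<bar>M * \<beta> - \<alpha>\<bar> = 1"
  shows "lattice_chart \<xi> (plane_chart \<Phi> p q M \<alpha> \<beta>)"
proof -
  define \<epsilon> where "\<epsilon> = M * \<beta> - \<alpha>"
  have \<epsilon>: "\<epsilon> = 1 \<or> \<epsilon> = - 1" using assms(3) by (auto simp: \<epsilon>_def abs_if split: if_splits)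
  have \<alpha>: "real_of_int \<alpha> = of_int M * of_int \<beta> - of_int \<epsilon>" by (simp add: \<epsilon>_def)
  define T :: "real^'a \<Rightarrow> real^'a" where "T = plane_chart id p q M \<alpha> \<beta>"
  define T' :: "real^'a \<Rightarrow> real^'a" where
    "T' y = (\<chi> i. if i = p then of_int \<epsilon> * (of_int \<beta> * y $ p - y $ q)
                  else if i = q then of_int \<epsilon> * (of_int M * y $ q - of_int \<alpha> * y $ p)
                  else y $ i)" for y
  have comp: "plane_chart \<Phi> p q M \<alpha> \<beta> = T \<circ> \<Phi>" by (simp add: fun_eq_iff T_def plane_chart_def)
  have T'T: "T' (T x) = x" and TT': "T (T' x) = x" for x
    using \<epsilon> assms(2) by (auto simp: T_def plane_chart_def T'_def vec_eq_iff \<alpha> algebra_simps)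
  have "linear T"
    by (rule linearI) (simp_all add: T_def plane_chart_def vec_eq_iff algebra_simps)
  moreover have "bij T" using T'T TT' by (metis bijI')
  moreover have "T ` {y. \<forall>i. y $ i \<in> \<int>} = {y. \<forall>i. y $ i \<in> \<int>}" (is "T ` ?Z = ?Z")
  proof (intro equalityI subsetI)
    show "y \<in> ?Z" if "y \<in> T ` ?Z" for y
      using that by (auto simp: T_def plane_chart_def)
    fix y assume "y \<in> ?Z"
    then have "T' y \<in> ?Z" by (auto simp: T'_def)
    then show "y \<in> T ` ?Z" using TT'[of y] by (metis image_eqI)
  qed
  ultimately show ?thesis
    using \<Phi> unfolding lattice_chart_def comp
    by (simp add: linear_compose bij_comp image_comp [symmetric] del: o_apply)
qed

section \<open>Counting in a parallelotope\<close>

text \<open>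
  The offset is half a unit so that the bounding hyperplanes of the box dilated by an odd number
  contain no lattice point.
\<close>
definition half_shifted_box :: "(real^'d::finite \<Rightarrow> real^'d) \<Rightarrow> ('d \<Rightarrow> nat) \<Rightarrow> (real^'d) set" where
  "half_shifted_box Y L = {x. \<forall>i. 1/2 \<le> Y x $ i \<and> Y x $ i \<le> real (L i) + 1/2}"

lemma half_shifted_box_vimage:
  "half_shifted_box Y L = Y -` cbox (\<chi> i. 1/2) (\<chi> i. real (L i) + 1/2)"
  by (auto simp: half_shifted_box_def mem_box_cart)

lemma half_shifted_box_polytope:
  assumes Y: "lattice_chart \<xi> Y" and L: "\<And>i. L i > 0"
  shows "half_shifted_box Y L \<in> convex_polytopes"
proof -
  have lin: "linear (inv_into UNIV Y)" and bij: "bij (inv_into UNIV Y)" and Y': "linear Y" "bij Y"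
    using Y by (auto simp: lattice_chart_def bij_imp_bij_inv bij_is_inj intro: inj_linear_imp_inv_linear)
  define Q :: "(real^'a) set" where "Q = cbox (\<chi> i. 1/2) (\<chi> i. real (L i) + 1/2)"
  have eq: "half_shifted_box Y L = inv_into UNIV Y ` Q"
    unfolding half_shifted_box_vimage Q_def using Y'(2) by (simp add: bij_vimage_eq_inv_image)
  have "(\<chi> i. real (L i) / 2 + 1/2) \<in> interior Q"
    using L by (simp add: Q_def interior_cbox mem_box_cart)
  then have "interior (half_shifted_box Y L) \<noteq> {}"
    unfolding eq using interior_injective_linear_image[OF lin bij_is_inj[OF bij], of Q] by auto
  moreover have "polytope (half_shifted_box Y L)"
    unfolding eq Q_def using lin polytope_interval by (rule polytope_linear_image)
  ultimately show ?thesis by (simp add: convex_polytopes_def)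
qed

lemma ints_in_nonintegral_interval:
  fixes r :: real
  assumes "r \<notin> \<int>"
  shows "{j::int. r \<le> j \<and> j \<le> r + real k} = {\<lfloor>r\<rfloor> <.. \<lfloor>r\<rfloor> + int k}"
proof (rule Set.set_eqI)
  fix j :: int
  have "r \<le> j \<longleftrightarrow> r < j" using assms by (metis Ints_of_int order_less_le)
  also have "\<dots> \<longleftrightarrow> \<lfloor>r\<rfloor> < j" by (simp add: floor_less_iff)
  finally have "r \<le> j \<longleftrightarrow> \<lfloor>r\<rfloor> < j" .
  moreover have "j \<le> r + real k \<longleftrightarrow> j \<le> \<lfloor>r\<rfloor> + int k"
    using le_floor_iff[of "j - int k" r] by auto
  ultimately show "j \<in> {j::int. r \<le> j \<and> j \<le> r + real k} \<longleftrightarrow> j \<in> {\<lfloor>r\<rfloor> <.. \<lfloor>r\<rfloor> + int k}"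
    by simp
qed

text \<open>
  After dilation by \<open>m\<close>, the lattice shifted by \<open>c\<close> avoids the hyperplanes that bound the
  parallelotope. Both bounding hyperplanes in a direction impose the same condition, because the
  dilated edge lengths are integers.
\<close>
definition generic_shift :: "(real^'d::finite \<Rightarrow> real^'d) \<Rightarrow> nat \<Rightarrow> real^'d \<Rightarrow> bool" where
  "generic_shift Y m c \<longleftrightarrow> (\<forall>i. real m / 2 - Y c $ i \<notin> \<int>)"

text \<open>
  In the chart coordinates a position is an integer vector, and the condition that all of \<open>S\<close> is
  hit decouples into one condition per coordinate: the coordinate lies in an interval with
  non-integral end points and integral length \<open>m L i - extent S (\<lambda>s. Y s $ i)\<close>. Such an interval
  contains as many integers as its length says.
\<close>
lemma hits_of_half_shifted_box:
  fixes Y :: "real^'d::finite \<Rightarrow> real^'d"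
  assumes Y: "lattice_chart \<xi> Y" and m: "m > 0"
    and S: "finite S" "S \<noteq> {}" "S \<subseteq> spanned_lattice \<xi>"
    and c: "generic_shift Y m c"
    and ext: "\<And>i. extent S (\<lambda>s. Y s $ i) \<le> real (m * L i)"
  defines "H \<equiv> {z \<in> spanned_lattice \<xi>. (\<lambda>b. (1 / real m) *\<^sub>R (z + c) + (1 / real m) *\<^sub>R b) ` S \<subseteq> half_shifted_box Y L}"
  shows "finite H \<and> real (card H) = (\<Prod>i\<in>UNIV. real (m * L i) - extent S (\<lambda>s. Y s $ i))"
proof -
  have lin: "linear Y" and inj: "inj Y" and im: "Y ` spanned_lattice \<xi> = {y. \<forall>i. y $ i \<in> \<int>}"
    using Y by (auto simp: lattice_chart_def bij_is_inj)
  define lo hi where "lo = (\<lambda>i. Min ((\<lambda>s. Y s $ i) ` S))" and "hi = (\<lambda>i. Max ((\<lambda>s. Y s $ i) ` S))"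
  have "lo i \<in> (\<lambda>s. Y s $ i) ` S" "hi i \<in> (\<lambda>s. Y s $ i) ` S" for i
    unfolding lo_def hi_def using S by (auto intro!: Min_in Max_in)
  then have Z: "lo i \<in> \<int>" "hi i \<in> \<int>" for i
    using lattice_chart_Ints[OF Y] S(3) by (metis (no_types, lifting) imageE subsetD)+
  have ext_eq: "extent S (\<lambda>s. Y s $ i) = hi i - lo i" for i
    by (simp add: extent_def lo_def hi_def)
  define r where "r = (\<lambda>i. real m / 2 - Y c $ i - lo i)"
  have r: "r i \<notin> \<int>" for i
  proof
    assume "r i \<in> \<int>"
    then have "r i + lo i \<in> \<int>" using Z by (intro Ints_add)
    then show False using c by (simp add: r_def generic_shift_def)
  qed
  define k where "k = (\<lambda>i. nat \<lfloor>real (m * L i) - (hi i - lo i)\<rfloor>)"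
  have k: "real (k i) = real (m * L i) - (hi i - lo i)" for i
  proof -
    have "real (m * L i) - (hi i - lo i) \<in> \<int>" using Z by (intro Ints_diff) auto
    then show ?thesis using ext[of i] by (simp add: k_def ext_eq of_int_floor)
  qed
  define T where "T = (\<lambda>i. {j::int. r i \<le> j \<and> j \<le> r i + real (k i)})"
  have T: "finite (T i)" "card (T i) = k i" for i
    by (simp_all add: T_def ints_in_nonintegral_interval[OF r])
  have mem: "z \<in> H \<longleftrightarrow> z \<in> spanned_lattice \<xi> \<and> (\<forall>i. r i \<le> Y z $ i \<and> Y z $ i \<le> r i + real (k i))" for z
  proof -
    have coord: "1/2 \<le> Y ((1 / real m) *\<^sub>R (z + c) + (1 / real m) *\<^sub>R b) $ i \<longleftrightarrow>
            real m / 2 - Y c $ i - Y z $ i \<le> Y b $ i"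
        "Y ((1 / real m) *\<^sub>R (z + c) + (1 / real m) *\<^sub>R b) $ i \<le> real (L i) + 1/2 \<longleftrightarrow>
            Y b $ i \<le> real (m * L i) + real m / 2 - Y c $ i - Y z $ i" for b i
      using m by (simp_all add: linear_add[OF lin] linear_scale[OF lin] field_simps)
    have "(\<lambda>b. (1 / real m) *\<^sub>R (z + c) + (1 / real m) *\<^sub>R b) ` S \<subseteq> half_shifted_box Y L \<longleftrightarrow>
        (\<forall>i. (\<forall>b\<in>S. real m / 2 - Y c $ i - Y z $ i \<le> Y b $ i) \<and>
             (\<forall>b\<in>S. Y b $ i \<le> real (m * L i) + real m / 2 - Y c $ i - Y z $ i))"
      unfolding half_shifted_box_def image_subset_iff mem_Collect_eq coord by blast
    also have "\<dots> \<longleftrightarrow> (\<forall>i. real m / 2 - Y c $ i - Y z $ i \<le> lo i \<and>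
             hi i \<le> real (m * L i) + real m / 2 - Y c $ i - Y z $ i)"
      unfolding lo_def hi_def using S(1,2) by (simp only: Min_ge_iff Max_le_iff finite_imageI image_is_empty ball_simps simp_thms) 
    also have "\<dots> \<longleftrightarrow> (\<forall>i. r i \<le> Y z $ i \<and> Y z $ i \<le> r i + real (k i))"
      unfolding k r_def by (intro all_cong1 conj_cong) (auto simp: algebra_simps)
    finally show ?thesis by (simp add: H_def)
  qed
  have "bij_betw (\<lambda>z i. \<lfloor>Y z $ i\<rfloor>) H (PiE UNIV T)"
  proof (rule bij_betw_imageI)
    have fl: "of_int \<lfloor>Y z $ i\<rfloor> = Y z $ i" if "z \<in> H" for z i
      using that lattice_chart_Ints[OF Y] by (simp add: mem of_int_floor)
    show "inj_on (\<lambda>z i. \<lfloor>Y z $ i\<rfloor>) H"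
    proof (rule inj_onI)
      fix z z' assume z: "z \<in> H" "z' \<in> H" and "(\<lambda>i. \<lfloor>Y z $ i\<rfloor>) = (\<lambda>i. \<lfloor>Y z' $ i\<rfloor>)"
      then have "Y z $ i = Y z' $ i" for i using fl[OF z(1), of i] fl[OF z(2), of i] by metis
      then have "Y z = Y z'" by (simp add: vec_eq_iff)
      then show "z = z'" using inj by (simp add: inj_eq)
    qed
    show "(\<lambda>z i. \<lfloor>Y z $ i\<rfloor>) ` H = PiE UNIV T"
    proof (intro equalityI subsetI)
      fix f assume "f \<in> (\<lambda>z i. \<lfloor>Y z $ i\<rfloor>) ` H"
      then obtain z where z: "z \<in> H" "f = (\<lambda>i. \<lfloor>Y z $ i\<rfloor>)" by blast
      have "f i \<in> T i" for i using z(1) unfolding T_def z(2) mem_Collect_eq fl[OF z(1)] mem by blast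
      then show "f \<in> PiE UNIV T" by (simp add: PiE_UNIV_domain)
    next
      fix f assume f: "f \<in> PiE UNIV T"
      have "(\<chi> i. real_of_int (f i)) \<in> Y ` spanned_lattice \<xi>" unfolding im by simp
      then obtain z where z: "z \<in> spanned_lattice \<xi>" "Y z = (\<chi> i. real_of_int (f i))" by auto
      have "z \<in> H" using f z by (auto simp: mem T_def PiE_UNIV_domain)
      moreover have "f = (\<lambda>i. \<lfloor>Y z $ i\<rfloor>)" by (simp add: z(2))
      ultimately show "f \<in> (\<lambda>z i. \<lfloor>Y z $ i\<rfloor>) ` H" by blast
    qed
  qed
  then have "finite H \<longleftrightarrow> finite (PiE UNIV T)" "card H = card (PiE UNIV T)"
    by (rule bij_betw_finite, rule bij_betw_same_card)
  then show ?thesis using T by (simp add: finite_PiE card_PiE k ext_eq)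
qed

lemma hit_count_half_shifted_box:
  fixes Y :: "real^'d::finite \<Rightarrow> real^'d"
  assumes Y: "lattice_chart \<xi> Y" and m: "m > 0" and S: "S \<noteq> {}" "S \<subseteq> grid_block \<xi> n"
    and c: "generic_shift Y m c"
    and ext: "\<And>i. extent (grid_block \<xi> n) (\<lambda>s. Y s $ i) \<le> real (m * L i)"
  shows "finite {z \<in> spanned_lattice \<xi>.
           (\<lambda>b. (1 / real m) *\<^sub>R (z + c) + (1 / real m) *\<^sub>R b) ` S \<subseteq> half_shifted_box Y L}"
    and "real (hit_or_miss_count \<xi> (1 / real m) c S {} (half_shifted_box Y L)) =
           (\<Prod>i\<in>UNIV. real (m * L i) - extent S (\<lambda>s. Y s $ i))"
proof -
  have "finite S" using S(2) finite_grid_block by (rule finite_subset)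
  moreover have "S \<subseteq> spanned_lattice \<xi>"
    using S(2) grid_block_subset_lattice by (rule order_trans)
  moreover have "extent S (\<lambda>s. Y s $ i) \<le> real (m * L i)" for i
    using extent_mono[OF finite_grid_block S(2,1)] ext order_trans by blast
  ultimately show "finite {z \<in> spanned_lattice \<xi>.
           (\<lambda>b. (1 / real m) *\<^sub>R (z + c) + (1 / real m) *\<^sub>R b) ` S \<subseteq> half_shifted_box Y L}"
    "real (hit_or_miss_count \<xi> (1 / real m) c S {} (half_shifted_box Y L)) =
           (\<Prod>i\<in>UNIV. real (m * L i) - extent S (\<lambda>s. Y s $ i))"
    using hits_of_half_shifted_box[OF Y m _ S(1) _ c, of L] by (auto simp: hit_or_miss_count_def)
qed

section \<open>From hits to configurations\<close>

text \<open>
  Among the positions at which \<open>B\<close> is hit and \<open>W\<close> is missed, \<open>v\<close> is either hit or missed.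
  Finiteness excludes the value \<open>0\<close> that \<open>card\<close> gives to infinite sets.
\<close>
lemma hit_or_miss_count_insert:
  assumes "finite {z \<in> spanned_lattice \<xi>. (\<lambda>b. a *\<^sub>R (z + c) + a *\<^sub>R b) ` B \<subseteq> X}"
  shows "real (hit_or_miss_count \<xi> a c B (insert v W) X) =
    real (hit_or_miss_count \<xi> a c B W X) - real (hit_or_miss_count \<xi> a c (insert v B) W X)"
proof -
  define H where "H = (\<lambda>B W. {z \<in> spanned_lattice \<xi>. (\<lambda>b. a *\<^sub>R (z + c) + a *\<^sub>R b) ` B \<subseteq> X \<and>
       (\<lambda>b. a *\<^sub>R (z + c) + a *\<^sub>R b) ` W \<subseteq> - X})"
  have "H B W = H B (insert v W) \<union> H (insert v B) W" "H B (insert v W) \<inter> H (insert v B) W = {}"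
    by (auto simp: H_def)
  moreover have "finite (H B (insert v W))" "finite (H (insert v B) W)"
    using assms by (auto simp: H_def elim!: rev_finite_subset)
  ultimately have "card (H B W) = card (H B (insert v W)) + card (H (insert v B) W)"
    by (simp add: card_Un_disjoint)
  then show ?thesis by (simp add: hit_or_miss_count_def H_def)
qed

text \<open>
  Inclusion-exclusion, done one white point at a time, expresses every hit-or-miss count by counts
  with no white points, by coefficients that do not depend on \<open>c\<close> and \<open>X\<close>. So a relation between
  the latter holds for all configurations.
\<close>
lemma hit_or_miss_relation:
  assumes fin: "\<And>j S. \<lbrakk>j \<in> J; S \<noteq> {}; S \<subseteq> G\<rbrakk> \<Longrightarrow>
      finite {z \<in> spanned_lattice \<xi>. (\<lambda>b. a *\<^sub>R (z + c j) + a *\<^sub>R b) ` S \<subseteq> X j}"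
    and rel: "\<And>S. \<lbrakk>S \<noteq> {}; S \<subseteq> G\<rbrakk> \<Longrightarrow>
      (\<Sum>j\<in>J. \<mu> j * real (hit_or_miss_count \<xi> a (c j) S {} (X j))) = 0"
    and "finite W" "W \<subseteq> G" "B \<noteq> {}" "B \<subseteq> G"
  shows "(\<Sum>j\<in>J. \<mu> j * real (hit_or_miss_count \<xi> a (c j) B W (X j))) = 0"
  using assms(3-)
proof (induction W arbitrary: B rule: finite_induct)
  case empty
  then show ?case using rel by simp
next
  case (insert v W)
  have "(\<Sum>j\<in>J. \<mu> j * real (hit_or_miss_count \<xi> a (c j) B (insert v W) (X j)))
      = (\<Sum>j\<in>J. \<mu> j * real (hit_or_miss_count \<xi> a (c j) B W (X j)))
        - (\<Sum>j\<in>J. \<mu> j * real (hit_or_miss_count \<xi> a (c j) (insert v B) W (X j)))"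
    unfolding sum_subtractf[symmetric] right_diff_distrib[symmetric]
    by (intro sum.cong refl arg_cong2[where f="(*)"] hit_or_miss_count_insert fin insert.prems)
  also have "\<dots> = 0"
    using insert.IH[of B] insert.IH[of "insert v B"] insert.prems by simp
  finally show ?case .
qed

text \<open>
  The index \<open>0\<close> already enumerates the only configuration without black points, so no other index
  does.
\<close>
lemma configuration_nonempty:
  assumes enum: "configuration_enumeration \<xi> n B W"
    and l: "l \<in> {1..2 ^ (n ^ CARD('d)) - 1}"
  shows "(B l :: (real^'d::finite) set) \<noteq> {}" "B l \<subseteq> grid_block \<xi> n" "W l \<subseteq> grid_block \<xi> n"
proof -
  have bij: "bij_betw (\<lambda>l. (B l, W l)) {0..2 ^ (n ^ CARD('d)) - 1} (configurations \<xi> n)"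
    and B0: "B 0 = {}"
    using enum by (auto simp: configuration_enumeration_def)
  have conf: "(B k, W k) \<in> configurations \<xi> n" if "k \<in> {0..2 ^ (n ^ CARD('d)) - 1}" for k
    using bij that by (auto simp: bij_betw_def)
  have l': "l \<in> {0..2 ^ (n ^ CARD('d)) - 1}" and "l \<noteq> 0" using l by auto
  show "B l \<subseteq> grid_block \<xi> n" "W l \<subseteq> grid_block \<xi> n"
    using conf[OF l'] by (auto simp: configurations_def)
  show "B l \<noteq> {}"
  proof
    assume "B l = {}"
    then have "(B l, W l) = (B 0, W 0)"
      using conf[OF l'] conf[of 0] B0 by (simp add: configurations_def)
    then show False
      using bij l' \<open>l \<noteq> 0\<close> by (auto simp: bij_betw_def dest: inj_onD)
  qed
qed

lemma local_estimator_relation: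
  fixes \<xi> :: "'d::finite \<Rightarrow> real^'d"
  assumes enum: "configuration_enumeration \<xi> n B W"
    and fin: "\<And>j S. \<lbrakk>j \<in> J; S \<noteq> {}; S \<subseteq> grid_block \<xi> n\<rbrakk> \<Longrightarrow>
      finite {z \<in> spanned_lattice \<xi>. (\<lambda>b. a *\<^sub>R (z + c j) + a *\<^sub>R b) ` S \<subseteq> X j}"
    and rel: "\<And>S. \<lbrakk>S \<noteq> {}; S \<subseteq> grid_block \<xi> n\<rbrakk> \<Longrightarrow>
      (\<Sum>j\<in>J. \<mu> j * real (hit_or_miss_count \<xi> a (c j) S {} (X j))) = 0"
  shows "(\<Sum>j\<in>J. \<mu> j * local_estimator \<xi> n B W w a (c j) (X j)) = 0"
proof -
  let ?I = "{1..(2::nat) ^ (n ^ CARD('d)) - 1}"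
  have "(\<Sum>j\<in>J. \<mu> j * local_estimator \<xi> n B W w a (c j) (X j))
     = (\<Sum>l\<in>?I. w l a * (\<Sum>j\<in>J. \<mu> j * real (hit_or_miss_count \<xi> a (c j) (B l) (W l) (X j))))"
    unfolding local_estimator_def sum_distrib_left
    by (subst sum.swap) (simp add: mult.left_commute)
  also have "\<dots> = 0"
  proof (intro sum.neutral ballI)
    fix l assume l: "l \<in> ?I"
    note c = configuration_nonempty[OF enum l]
    have "(\<Sum>j\<in>J. \<mu> j * real (hit_or_miss_count \<xi> a (c j) (B l) (W l) (X j))) = 0"
      using fin rel finite_subset[OF c(3) finite_grid_block] c(3,1,2) by (rule hit_or_miss_relation)
    then show "w l a * (\<Sum>j\<in>J. \<mu> j * real (hit_or_miss_count \<xi> a (c j) (B l) (W l) (X j))) = 0"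
      by simp
  qed
  finally show ?thesis .
qed

text \<open>
  Hit counts do not depend on the shift as long as it is generic; equality for two shifts is the
  linear relation with coefficients \<open>1\<close> and \<open>- 1\<close>.
\<close>
lemma local_estimator_generic_shift:
  assumes "configuration_enumeration \<xi> n B W" "lattice_chart \<xi> Y" "m > 0"
    and "generic_shift Y m c" "generic_shift Y m c'"
    and "\<And>i. extent (grid_block \<xi> n) (\<lambda>s. Y s $ i) \<le> real (m * L i)"
  shows "local_estimator \<xi> n B W w (1 / real m) c (half_shifted_box Y L) =
    local_estimator \<xi> n B W w (1 / real m) c' (half_shifted_box Y L)"
proof -
  have "(\<Sum>j\<in>UNIV. (if j then 1 else - 1) *
      local_estimator \<xi> n B W w (1 / real m) (if j then c else c') (half_shifted_box Y L)) = 0"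
  proof (rule local_estimator_relation[OF assms(1)])
    fix j :: bool and S assume S: "S \<noteq> {}" "S \<subseteq> grid_block \<xi> n"
    have c: "generic_shift Y m (if j then c else c')" for j using assms(4,5) by simp
    note count = hit_count_half_shifted_box[OF assms(2,3) S c assms(6)]
    show "finite {z \<in> spanned_lattice \<xi>. (\<lambda>b. (1 / real m) *\<^sub>R (z + (if j then c else c')) +
        (1 / real m) *\<^sub>R b) ` S \<subseteq> half_shifted_box Y L}"
      by (rule count(1))
    show "(\<Sum>j\<in>UNIV. (if j then 1 else - 1) * real (hit_or_miss_count \<xi> (1 / real m)
        (if j then c else c') S {} (half_shifted_box Y L))) = 0"
      unfolding count(2) by (simp add: UNIV_bool)
  qed
  then show ?thesis by (simp add: UNIV_bool)
qed

section \<open>The mean\<close>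

text \<open>
  The exceptional shifts lie on countably many hyperplanes.
\<close>
lemma AE_generic_shift:
  fixes Y :: "real^'d::finite \<Rightarrow> real^'d"
  assumes "lattice_chart \<xi> Y"
  shows "AE c in lborel. generic_shift Y m c"
proof -
  have lin: "linear Y" and bij: "bij Y" using assms by (auto simp: lattice_chart_def)
  have cont: "continuous_on UNIV (\<lambda>c. Y c $ i)" for i
    using lin by (intro continuous_intros linear_continuous_on) (simp add: linear_conv_bounded_linear)
  have AE: "AE c in lborel. Y c $ i \<noteq> t" for i t
  proof -
    have inner: "adjoint Y (axis i 1) \<bullet> c = Y c $ i" for c
      using adjoint_works[OF lin, of c "axis i 1"]
      by (simp add: inner_axis inner_commute[of _ c])
    obtain c where "Y c = axis i 1" using bij_is_surj[OF bij] by (rule surjE[where y="axis i 1"]) simp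
    then have "adjoint Y (axis i 1) \<noteq> 0" using inner[of c] by (auto simp: axis_def)
    then have "negligible {c. Y c $ i = t}"
      using negligible_hyperplane[of "adjoint Y (axis i 1)" t] by (simp add: inner)
    moreover have "{c. Y c $ i = t} \<in> sets lborel"
      using closed_Collect_eq[OF cont continuous_on_const, of i t] by (simp add: borel_closed)
    ultimately have "{c. Y c $ i = t} \<in> null_sets lborel"
      by (simp add: negligible_iff_null_sets null_sets_completion_iff)
    then show ?thesis by (rule AE_I') auto
  qed
  have "AE c in lborel. \<forall>i. \<forall>k::int. Y c $ i \<noteq> real m / 2 - of_int k"
    unfolding AE_all_countable using AE by blast
  then show ?thesis
  proof (rule AE_mp, intro AE_I2 impI)
    fix c assume "\<forall>i. \<forall>k::int. Y c $ i \<noteq> real m / 2 - of_int k"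
    then show "generic_shift Y m c"
      unfolding generic_shift_def by (metis Ints_cases diff_diff_eq2 add_diff_cancel_left')
  qed
qed

lemma prob_unit_cell:
  assumes "positively_oriented_basis \<xi>"
  shows "unit_cell \<xi> \<in> sets lborel" "measure (uniform_measure lborel (unit_cell \<xi>)) UNIV = 1"
proof -
  define A where "A = basis_matrix \<xi>"
  have "det A \<noteq> 0" using assms by (simp add: positively_oriented_basis_def A_def basis_matrix_def)
  have A: "A *v x = (\<Sum>i\<in>UNIV. x $ i *\<^sub>R \<xi> i)" for x
    by (simp add: A_def basis_matrix_mult)
  have cell: "unit_cell \<xi> = (*v) A ` cbox 0 1"
  proof (intro equalityI subsetI)
    fix x assume "x \<in> unit_cell \<xi>"
    then obtain t where "x = (\<Sum>i\<in>UNIV. t i *\<^sub>R \<xi> i)" "\<forall>i. 0 \<le> t i \<and> t i \<le> 1"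
      by (auto simp: unit_cell_def)
    then show "x \<in> (*v) A ` cbox 0 1"
      by (intro image_eqI[of _ _ "\<chi> i. t i"]) (simp_all add: A mem_box_cart)
  qed (auto simp: unit_cell_def A mem_box_cart)
  have comp: "compact (unit_cell \<xi>)"
    unfolding cell by (intro compact_continuous_image linear_continuous_on compact_cbox) simp
  then show sets: "unit_cell \<xi> \<in> sets lborel" by (simp add: borel_compact)
  have "inj ((*v) A)"
    using \<open>det A \<noteq> 0\<close> by (intro inj_matrix_vector_mult) (simp add: invertible_det_nz)
  then have "interior (unit_cell \<xi>) = (*v) A ` box 0 1"
    unfolding cell by (subst interior_injective_linear_image) (simp_all add: interior_cbox)
  moreover have "(\<chi> i. 1/2) \<in> box 0 (1 :: real^'a)" by (simp add: mem_box_cart)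
  ultimately have "interior (unit_cell \<xi>) \<noteq> {}" by blast
  then have "\<not> negligible (unit_cell \<xi>)"
    using open_not_negligible[OF open_interior] negligible_subset[OF _ interior_subset] by blast
  then have "emeasure lborel (unit_cell \<xi>) \<noteq> 0"
    using sets by (auto simp: negligible_iff_null_sets null_sets_completion_iff)
  moreover have "emeasure lborel (unit_cell \<xi>) \<noteq> \<infinity>"
    using emeasure_compact_finite[OF comp] by simp
  ultimately have "emeasure (uniform_measure lborel (unit_cell \<xi>)) UNIV = 1"
    using sets by (simp add: ennreal_divide_self less_top zero_less_iff_neq_zero)
  then show "measure (uniform_measure lborel (unit_cell \<xi>)) UNIV = 1"
    by (simp add: measure_def)
qed

text \<open>
  The count is the number of lattice points \<open>z\<close> for which \<open>c\<close> belongs to a Borel set depending on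
  \<open>z\<close>, and the lattice is countable.
\<close>
lemma measurable_hit_or_miss_count:
  fixes \<xi> :: "'d::finite \<Rightarrow> real^'d"
  assumes "closed X" "finite B" "finite W"
  shows "(\<lambda>c. real (hit_or_miss_count \<xi> a c B W X)) \<in> borel_measurable borel"
proof -
  let ?\<Lambda> = "spanned_lattice \<xi>"
  have "?\<Lambda> \<subseteq> (\<lambda>k. \<Sum>i\<in>UNIV. of_int (k i) *\<^sub>R \<xi> i) ` (PiE UNIV (\<lambda>_. UNIV))"
    by (auto simp: spanned_lattice_def)
  then have \<Lambda>: "countable ?\<Lambda>"
    by (rule countable_subset) (intro countable_image countable_PiE, auto)
  define P where "P z c \<longleftrightarrow> (\<lambda>b. a *\<^sub>R (z + c) + a *\<^sub>R b) ` B \<subseteq> X \<and>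
      (\<lambda>b. a *\<^sub>R (z + c) + a *\<^sub>R b) ` W \<subseteq> - X" for z c
  have X: "X \<in> sets borel" using assms(1) by (rule borel_closed)
  have P: "{c. P z c} \<in> sets borel" for z
  proof -
    have "(\<lambda>c. a *\<^sub>R (z + c) + a *\<^sub>R b) \<in> borel_measurable borel" for b
      by measurable
    from measurable_sets[OF this X]
    have b: "{c. a *\<^sub>R (z + c) + a *\<^sub>R b \<in> X} \<in> sets borel" for b
      by (simp add: vimage_def)
    have "{c. P z c} = (\<Inter>b\<in>B. {c. a *\<^sub>R (z + c) + a *\<^sub>R b \<in> X}) \<inter>
        (\<Inter>b\<in>W. - {c. a *\<^sub>R (z + c) + a *\<^sub>R b \<in> X})"
      by (auto simp: P_def)
    also have "\<dots> \<in> sets borel"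
      using b assms(2,3)
      by (cases "B = {}"; cases "W = {}") (auto intro!: sets.Int sets.finite_INT borel_comp)
    finally show ?thesis .
  qed
  \<comment> \<open>Numbering the lattice makes \<open>measurable_card\<close> applicable.\<close>
  define I where "I c = to_nat_on ?\<Lambda> ` {z \<in> ?\<Lambda>. P z c}" for c
  have "hit_or_miss_count \<xi> a c B W X = card (I c)" for c
    unfolding I_def hit_or_miss_count_def P_def
    by (rule card_image [symmetric]) (rule inj_on_subset[OF inj_on_to_nat_on[OF \<Lambda>]], blast)
  moreover have "{c \<in> space borel. i \<in> I c} \<in> sets borel" for i
  proof -
    have "{c \<in> space borel. i \<in> I c} = (\<Union>z\<in>{z\<in>?\<Lambda>. i = to_nat_on ?\<Lambda> z}. {c. P z c})"
      by (auto simp: I_def)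
    also have "\<dots> \<in> sets borel"
      using \<Lambda> P by (intro sets.countable_UN') (auto intro: countable_subset)
    finally show ?thesis .
  qed
  ultimately show ?thesis
    using measurable_compose[OF measurable_card[of borel I], of real borel] by simp
qed

text \<open>
  The estimator is almost everywhere constant in the shift.
\<close>
lemma mean_local_estimator_eq:
  fixes \<xi> :: "'d::finite \<Rightarrow> real^'d"
  assumes pos: "positively_oriented_basis \<xi>" and enum: "configuration_enumeration \<xi> n B W"
    and Y: "lattice_chart \<xi> Y" and m: "m > 0" and c: "generic_shift Y m c"
    and ext: "\<And>i. extent (grid_block \<xi> n) (\<lambda>s. Y s $ i) \<le> real (m * L i)"
  shows "mean_local_estimator \<xi> n B W w (1 / real m) (half_shifted_box Y L) =
    local_estimator \<xi> n B W w (1 / real m) c (half_shifted_box Y L)"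
proof -
  let ?X = "half_shifted_box Y L"
  let ?M = "uniform_measure lborel (unit_cell \<xi>)"
  note cell = prob_unit_cell[OF pos]
  have "continuous_on UNIV Y"
    using Y by (simp add: lattice_chart_def linear_continuous_on linear_conv_bounded_linear)
  then have X: "closed ?X"
    unfolding half_shifted_box_vimage by (intro closed_vimage closed_cbox)
  have "(\<lambda>c. real (hit_or_miss_count \<xi> (1 / real m) c (B l) (W l) ?X)) \<in> borel_measurable borel"
    if "l \<in> {1..2 ^ (n ^ CARD('d)) - 1}" for l
    using configuration_nonempty[OF enum that] finite_subset[OF _ finite_grid_block]
    by (intro measurable_hit_or_miss_count X) blast+
  then have meas: "(\<lambda>c. local_estimator \<xi> n B W w (1 / real m) c ?X) \<in> borel_measurable ?M"
    unfolding local_estimator_def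
    by (intro borel_measurable_sum borel_measurable_times borel_measurable_const)
       (simp add: measurable_cong_sets[OF sets_uniform_measure refl])
  have "AE c' in ?M. local_estimator \<xi> n B W w (1 / real m) c' ?X
      = local_estimator \<xi> n B W w (1 / real m) c ?X"
    using AE_generic_shift[OF Y, of m]
    by (intro AE_uniform_measureI cell(1), elim AE_mp)
       (intro AE_I2 impI local_estimator_generic_shift[OF enum Y m _ c ext])
  then have "mean_local_estimator \<xi> n B W w (1 / real m) ?X
      = integral\<^sup>L ?M (\<lambda>_. local_estimator \<xi> n B W w (1 / real m) c ?X)"
    unfolding mean_local_estimator_def by (intro integral_cong_AE meas) simp
  also have "\<dots> = local_estimator \<xi> n B W w (1 / real m) c ?X"
    using cell(2) by simp
  finally show ?thesis .
qed

section \<open>Linearly dependent parallelotopes\<close>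

text \<open>
  The edge length \<open>L\<close> in direction \<open>q\<close> is \<open>\<beta> j\<close>, so the factor of the count for this direction,
  \<open>m \<beta> - (\<alpha> u + \<beta> v)\<close>, is linear in \<open>(\<alpha>, \<beta>)\<close>. The other factors are common to all \<open>j\<close>. Hence the
  counts inherit every linear dependence of the vectors \<open>(\<alpha> j, \<beta> j)\<close>.
\<close>
lemma hit_count_relation:
  fixes \<xi> :: "'d::finite \<Rightarrow> real^'d" and q :: 'd and \<alpha> :: "'j \<Rightarrow> int" and \<beta> :: "'j \<Rightarrow> nat"
  defines "L \<equiv> (\<lambda>j i. if i = q then \<beta> j else 1)"
  assumes \<Phi>: "lattice_chart \<xi> \<Phi>" "\<forall>x\<in>grid_block \<xi> n. \<forall>i. \<exists>k<n. \<Phi> x $ i = real k"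
    and pq: "p \<noteq> q" and "finite J"
    and uni: "\<And>j. j \<in> J \<Longrightarrow> \<bar>M * int (\<beta> j) - \<alpha> j\<bar> = 1"
    and cone: "\<And>j. j \<in> J \<Longrightarrow> int n * int (\<beta> j) \<le> \<alpha> j"
    and dep: "(\<Sum>j\<in>J. \<mu> j * real_of_int (\<alpha> j)) = 0" "(\<Sum>j\<in>J. \<mu> j * real (\<beta> j)) = 0"
    and m: "m > 0"
    and c: "\<And>j. j \<in> J \<Longrightarrow> generic_shift (plane_chart \<Phi> p q M (\<alpha> j) (int (\<beta> j))) m (c j)"
    and ext: "\<And>j i. j \<in> J \<Longrightarrow>
       extent (grid_block \<xi> n) (\<lambda>s. plane_chart \<Phi> p q M (\<alpha> j) (int (\<beta> j)) s $ i) \<le> real (m * L j i)"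
    and S: "S \<noteq> {}" "S \<subseteq> grid_block \<xi> n"
  shows "(\<Sum>j\<in>J. \<mu> j * real (hit_or_miss_count \<xi> (1 / real m) (c j) S {}
      (half_shifted_box (plane_chart \<Phi> p q M (\<alpha> j) (int (\<beta> j))) (L j)))) = 0"
proof -
  define f where "f = (\<lambda>x i. \<lfloor>\<Phi> x $ i\<rfloor>)"
  have f: "\<Phi> x $ i = of_int (f x i)" "0 \<le> f x i \<and> f x i < int n" if x: "x \<in> S" for x i
  proof -
    obtain k where "k < n" "\<Phi> x $ i = real k" using \<Phi>(2) x S(2) by blast
    then show "\<Phi> x $ i = of_int (f x i)" "0 \<le> f x i \<and> f x i < int n" by (simp_all add: f_def)
  qed
  have finS: "finite S" using S(2) finite_grid_block by (rule finite_subset)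
  obtain u v where uv: "\<And>\<alpha> \<beta>. \<lbrakk>0 \<le> \<beta>; int n * \<beta> \<le> \<alpha>\<rbrakk> \<Longrightarrow>
      extent S (\<lambda>x. of_int (\<alpha> * f x p + \<beta> * f x q)) = of_int \<alpha> * u + of_int \<beta> * v"
    using extent_linear_on_cone[OF finS S(1), of "\<lambda>x. f x q" "int n" "\<lambda>x. f x p", OF f(2)]
    by blast
  \<comment> \<open>The values \<open>0\<close> for \<open>\<alpha>\<close> and \<open>\<beta>\<close> are arbitrary, since they only enter the coordinate \<open>q\<close>.\<close>
  define R where "R = (\<Prod>i\<in>UNIV - {q}. real m - extent S (\<lambda>s. plane_chart \<Phi> p q M 0 0 s $ i))"
  have count: "real (hit_or_miss_count \<xi> (1 / real m) (c j) S {}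
      (half_shifted_box (plane_chart \<Phi> p q M (\<alpha> j) (int (\<beta> j))) (L j)))
      = (real m * real (\<beta> j) - (of_int (\<alpha> j) * u + real (\<beta> j) * v)) * R" if j: "j \<in> J" for j
  proof -
    let ?Y = "plane_chart \<Phi> p q M (\<alpha> j) (int (\<beta> j))"
    have "real (hit_or_miss_count \<xi> (1 / real m) (c j) S {} (half_shifted_box ?Y (L j)))
        = (\<Prod>i\<in>UNIV. real (m * L j i) - extent S (\<lambda>s. ?Y s $ i))"
      by (rule hit_count_half_shifted_box(2)[OF lattice_chart_plane_chart[OF \<Phi>(1) pq uni[OF j]]
            m S c[OF j] ext[OF j]])
    also have "\<dots> = (real (m * L j q) - extent S (\<lambda>s. ?Y s $ q)) *
        (\<Prod>i\<in>UNIV - {q}. real (m * L j i) - extent S (\<lambda>s. ?Y s $ i))"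
      by (rule prod.remove) auto
    also have "extent S (\<lambda>s. ?Y s $ q) = extent S (\<lambda>x. of_int (\<alpha> j * f x p + int (\<beta> j) * f x q))"
      using pq by (intro extent_cong) (simp add: plane_chart_def f(1))
    also have "\<dots> = of_int (\<alpha> j) * u + real (\<beta> j) * v"
      using uv[of "int (\<beta> j)" "\<alpha> j"] cone[OF j] by simp
    also have "(\<Prod>i\<in>UNIV - {q}. real (m * L j i) - extent S (\<lambda>s. ?Y s $ i)) = R"
      unfolding R_def by (intro prod.cong refl) (auto simp: L_def plane_chart_def intro: extent_cong)
    finally show ?thesis by (simp add: L_def)
  qed
  have "(\<Sum>j\<in>J. \<mu> j * real (hit_or_miss_count \<xi> (1 / real m) (c j) S {}
      (half_shifted_box (plane_chart \<Phi> p q M (\<alpha> j) (int (\<beta> j))) (L j))))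
    = (\<Sum>j\<in>J. (real m - v) * R * (\<mu> j * real (\<beta> j)) - u * R * (\<mu> j * real_of_int (\<alpha> j)))"
    by (intro sum.cong refl) (simp add: count algebra_simps)
  also have "\<dots> = 0"
    by (simp add: sum_subtractf dep flip: sum_distrib_left)
  finally show ?thesis .
qed

lemma extents_eventually_le:
  fixes f :: "'j \<Rightarrow> 'i::finite \<Rightarrow> 'a \<Rightarrow> real"
  assumes "finite J" "\<And>j i. j \<in> J \<Longrightarrow> L j i > 0"
  shows "\<forall>\<^sub>F k in sequentially. \<forall>j\<in>J. \<forall>i. extent G (f j i) \<le> real ((2 * k + 1) * L j i)"
proof (intro eventually_ball_finite assms(1) ballI eventually_all_finite)
  fix j i assume j: "j \<in> J"
  show "\<forall>\<^sub>F k in sequentially. extent G (f j i) \<le> real ((2 * k + 1) * L j i)"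
    using eventually_ge_at_top[of "nat \<lceil>extent G (f j i)\<rceil>"]
  proof eventually_elim
    case (elim k)
    have "extent G (f j i) \<le> real k" using elim by linarith
    also have "\<dots> \<le> real ((2 * k + 1) * L j i)"
      using assms(2)[OF j, of i] by (intro of_nat_mono) (cases "L j i", auto)
    finally show ?case .
  qed
qed

lemma inverse_odd_at_right_0:
  "filterlim (\<lambda>k. 1 / real (2 * k + 1)) (at_right 0) sequentially"
proof -
  have "strict_mono (\<lambda>k::nat. 2 * k + 1)" by (simp add: strict_mono_def)
  then have "filterlim (\<lambda>k. real (2 * k + 1)) at_top sequentially"
    by (intro filterlim_compose[OF filterlim_real_sequentially] filterlim_subseq)
  then show ?thesis
    using filterlim_compose[OF filterlim_inverse_at_right_top] by (simp add: inverse_eq_divide)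
qed

lemma half_odd_not_Int: "real (2 * k + 1) / 2 \<notin> \<int>"
proof
  assume "real (2 * k + 1) / 2 \<in> \<int>"
  then obtain j :: int where "real (2 * k + 1) / 2 = of_int j" by (auto elim: Ints_cases)
  then have "real_of_int (2 * int k + 1) = of_int (2 * j)" by simp
  then have "2 * int k + 1 = 2 * j" by (simp only: of_int_eq_iff)
  then show False by presburger
qed

text \<open>
  The estimators of three polytopes satisfy a linear relation whose coefficients do not sum to
  zero, on a sequence of meshes tending to zero. The meshes are inverses of odd integers, so that
  the unshifted lattice is generic.
\<close>
lemma dependent_polytopes:
  fixes \<xi> :: "'d::finite \<Rightarrow> real^'d"
  assumes card: "CARD('d) > 1" and pos: "positively_oriented_basis \<xi>"
    and enum: "configuration_enumeration \<xi> n B W"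
  obtains P1 P2 P3 where "{P1, P2, P3} \<subseteq> convex_polytopes"
    "\<forall>\<^sub>F k in sequentially. let a = 1 / real (2 * k + 1) in
       3 * local_estimator \<xi> n B W w a 0 P1 + local_estimator \<xi> n B W w a 0 P2
         - 2 * local_estimator \<xi> n B W w a 0 P3 = 0 \<and>
       (\<forall>P\<in>{P1, P2, P3}. mean_local_estimator \<xi> n B W w a P = local_estimator \<xi> n B W w a 0 P)"
proof -
  obtain p q :: 'd where pq: "p \<noteq> q"
    using card card_le_Suc0_iff_eq[of "UNIV :: 'd set"] by (metis One_nat_def UNIV_I finite linorder_not_less)
  obtain \<Phi> where \<Phi>: "lattice_chart \<xi> \<Phi>"
      "\<forall>x\<in>grid_block \<xi> n. \<forall>i. \<exists>k<n. \<Phi> x $ i = real k"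
    by (rule coordinate_chart[OF pos, of n])
  \<comment> \<open>With \<open>u = (M, 1)\<close> and \<open>v = (1, 0)\<close>, the three vectors \<open>(\<alpha> j, \<beta> j)\<close> are \<open>u + v\<close>, \<open>u - v\<close> and
    \<open>2 u + v\<close>. The second one is in the cone \<open>n \<beta> \<le> \<alpha>\<close> just because \<open>M > n\<close>.\<close>
  define M where "M = int n + 1"
  define \<alpha> where "\<alpha> = (!) [M + 1, M - 1, 2 * M + 1]"
  define \<beta> where "\<beta> = (!) [1, 1, 2 :: nat]"
  define \<mu> where "\<mu> = (!) [3, 1, - 2 :: real]"
  define J where "J = {0, 1, 2 :: nat}"
  define Y where "Y j = plane_chart \<Phi> p q M (\<alpha> j) (int (\<beta> j))" for j
  define L where "L = (\<lambda>j i. if i = q then \<beta> j else 1)"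
  define P where "P j = half_shifted_box (Y j) (L j)" for j
  have finJ: "finite J" by (simp add: J_def)
  have uni: "\<bar>M * int (\<beta> j) - \<alpha> j\<bar> = 1" if "j \<in> J" for j
    using that by (auto simp: J_def \<alpha>_def \<beta>_def)
  have cone: "int n * int (\<beta> j) \<le> \<alpha> j" if "j \<in> J" for j
    using that by (auto simp: J_def \<alpha>_def \<beta>_def M_def)
  have dep: "(\<Sum>j\<in>J. \<mu> j * real_of_int (\<alpha> j)) = 0" "(\<Sum>j\<in>J. \<mu> j * real (\<beta> j)) = 0"
    by (simp_all add: J_def \<alpha>_def \<beta>_def \<mu>_def)
  have Y: "lattice_chart \<xi> (Y j)" if "j \<in> J" for j
    unfolding Y_def using \<Phi>(1) pq uni[OF that] by (rule lattice_chart_plane_chart)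
  have L: "L j i > 0" if "j \<in> J" for j i using that by (auto simp: L_def \<beta>_def J_def)
  have gen: "generic_shift (Y j) (2 * k + 1) 0" if "j \<in> J" for j k
    using Y[OF that] half_odd_not_Int[of k] linear_0[of "Y j"]
    by (simp add: generic_shift_def lattice_chart_def)
  have *: "\<forall>\<^sub>F k in sequentially.
      (\<Sum>j\<in>J. \<mu> j * local_estimator \<xi> n B W w (1 / real (2 * k + 1)) 0 (P j)) = 0 \<and>
      (\<forall>j\<in>J. mean_local_estimator \<xi> n B W w (1 / real (2 * k + 1)) (P j)
         = local_estimator \<xi> n B W w (1 / real (2 * k + 1)) 0 (P j))"
    using extents_eventually_le[where J=J and L=L and G="grid_block \<xi> n" and
        f="\<lambda>j i s. Y j s $ i", OF finJ L]
  proof (rule eventually_mono)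
    fix k assume "\<forall>j\<in>J. \<forall>i. extent (grid_block \<xi> n) (\<lambda>s. Y j s $ i) \<le> real ((2 * k + 1) * L j i)"
    then have ext: "extent (grid_block \<xi> n) (\<lambda>s. Y j s $ i) \<le> real ((2 * k + 1) * L j i)"
      if "j \<in> J" for j i using that by blast
    have m: "2 * k + 1 > 0" by simp
    show "(\<Sum>j\<in>J. \<mu> j * local_estimator \<xi> n B W w (1 / real (2 * k + 1)) 0 (P j)) = 0 \<and>
      (\<forall>j\<in>J. mean_local_estimator \<xi> n B W w (1 / real (2 * k + 1)) (P j)
         = local_estimator \<xi> n B W w (1 / real (2 * k + 1)) 0 (P j))"
    proof (intro conjI ballI)
      show "(\<Sum>j\<in>J. \<mu> j * local_estimator \<xi> n B W w (1 / real (2 * k + 1)) 0 (P j)) = 0"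
        unfolding P_def
      proof (rule local_estimator_relation[OF enum])
        fix S assume S: "S \<noteq> {}" "S \<subseteq> grid_block \<xi> n"
        show "finite {z \<in> spanned_lattice \<xi>. (\<lambda>b. (1 / real (2 * k + 1)) *\<^sub>R (z + 0)
            + (1 / real (2 * k + 1)) *\<^sub>R b) ` S \<subseteq> half_shifted_box (Y j) (L j)}" if "j \<in> J" for j
          by (rule hit_count_half_shifted_box(1)[OF Y[OF that] m S gen[OF that] ext[OF that]])
        show "(\<Sum>j\<in>J. \<mu> j * real (hit_or_miss_count \<xi> (1 / real (2 * k + 1)) 0 S {}
            (half_shifted_box (Y j) (L j)))) = 0"
          using hit_count_relation[OF \<Phi> pq finJ uni cone dep m gen[unfolded Y_def]
              ext[unfolded Y_def L_def] S]
          unfolding Y_def L_def .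
      qed
      show "mean_local_estimator \<xi> n B W w (1 / real (2 * k + 1)) (P j)
          = local_estimator \<xi> n B W w (1 / real (2 * k + 1)) 0 (P j)" if "j \<in> J" for j
        unfolding P_def
        by (rule mean_local_estimator_eq[OF pos enum Y[OF that] m gen[OF that] ext[OF that]])
    qed
  qed
  show thesis
  proof
    show "{P 0, P 1, P 2} \<subseteq> convex_polytopes"
      using half_shifted_box_polytope[OF Y L] by (auto simp: P_def J_def)
    show "\<forall>\<^sub>F k in sequentially. let a = 1 / real (2 * k + 1) in
       3 * local_estimator \<xi> n B W w a 0 (P 0) + local_estimator \<xi> n B W w a 0 (P 1)
         - 2 * local_estimator \<xi> n B W w a 0 (P 2) = 0 \<and>
       (\<forall>Q\<in>{P 0, P 1, P 2}. mean_local_estimator \<xi> n B W w a Q = local_estimator \<xi> n B W w a 0 Q)"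
      using *
    proof (rule eventually_mono, goal_cases)
      case (1 k)
      let ?e = "\<lambda>j. local_estimator \<xi> n B W w (1 / real (2 * k + 1)) 0 (P j)"
      have "(\<Sum>j\<in>J. \<mu> j * ?e j) = 3 * ?e 0 + ?e 1 - 2 * ?e 2"
        by (simp add: J_def \<mu>_def)
      then show ?case using 1 by (simp only: Let_def J_def) blast
    qed
  qed
qed

theorem theorem1p2:
  fixes \<xi> :: "'d::finite \<Rightarrow> real^'d"
    and n :: nat
    and B W :: "nat \<Rightarrow> (real^'d) set"
    and w :: "nat \<Rightarrow> real \<Rightarrow> real"
  assumes "CARD('d) > 1"
    and "positively_oriented_basis \<xi>"
    and "configuration_enumeration \<xi> n B W"
    and "motion_reflection_invariant \<xi> n B w"
  shows "(\<exists>P\<in>convex_polytopes.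
            \<not> tendsto (\<lambda>a. mean_local_estimator \<xi> n B W w a P) (euler_characteristic P) (at_right 0)) \<and>
         \<not> multigrid_convergent \<xi> n B W w convex_polytopes"
proof -
  obtain P1 P2 P3 where P: "{P1, P2, P3} \<subseteq> convex_polytopes"
    and rel: "\<forall>\<^sub>F k in sequentially. let a = 1 / real (2 * k + 1) in
       3 * local_estimator \<xi> n B W w a 0 P1 + local_estimator \<xi> n B W w a 0 P2
         - 2 * local_estimator \<xi> n B W w a 0 P3 = 0 \<and>
       (\<forall>P\<in>{P1, P2, P3}. mean_local_estimator \<xi> n B W w a P = local_estimator \<xi> n B W w a 0 P)"
    by (rule dependent_polytopes[OF assms(1-3)])
  have \<chi>: "euler_characteristic Q = 1" if "Q \<in> {P1, P2, P3}" for Q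
  proof (rule euler_characteristic_convex)
    have "Q \<in> convex_polytopes" using P that by blast
    then show "convex Q" "Q \<noteq> {}"
      by (auto simp: convex_polytopes_def polytope_imp_convex)
  qed
  have no_limit: False
    if lim: "\<And>Q. Q \<in> {P1, P2, P3} \<Longrightarrow> ((\<lambda>a. F a Q) \<longlongrightarrow> euler_characteristic Q) (at_right 0)"
      and F: "\<forall>\<^sub>F k in sequentially. let a = 1 / real (2 * k + 1) in 3 * F a P1 + F a P2 - 2 * F a P3 = 0"
    for F :: "real \<Rightarrow> (real^'d) set \<Rightarrow> real"
  proof -
    have "((\<lambda>k. F (1 / real (2 * k + 1)) Q) \<longlongrightarrow> 1) sequentially" if "Q \<in> {P1, P2, P3}" for Q
      using filterlim_compose[OF lim[OF that] inverse_odd_at_right_0] unfolding \<chi>[OF that] .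
    then have "(\<lambda>k. 3 * F (1 / real (2 * k + 1)) P1 + F (1 / real (2 * k + 1)) P2
        - 2 * F (1 / real (2 * k + 1)) P3) \<longlonglongrightarrow> 3 * 1 + 1 - 2 * 1"
      by (intro tendsto_intros) auto
    moreover have "(\<lambda>k. 3 * F (1 / real (2 * k + 1)) P1 + F (1 / real (2 * k + 1)) P2
        - 2 * F (1 / real (2 * k + 1)) P3) \<longlonglongrightarrow> 0"
      using F unfolding Let_def by (rule tendsto_eventually)
    ultimately show False using LIMSEQ_unique by fastforce
  qed
  show ?thesis
  proof
    have "\<forall>\<^sub>F k in sequentially. let a = 1 / real (2 * k + 1) in
        3 * mean_local_estimator \<xi> n B W w a P1 + mean_local_estimator \<xi> n B W w a P2
          - 2 * mean_local_estimator \<xi> n B W w a P3 = 0"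
      using rel by eventually_elim (simp add: Let_def)
    then show "\<exists>P\<in>convex_polytopes.
        \<not> tendsto (\<lambda>a. mean_local_estimator \<xi> n B W w a P) (euler_characteristic P) (at_right 0)"
      using no_limit[of "mean_local_estimator \<xi> n B W w"] P by blast
    have "\<forall>\<^sub>F k in sequentially. let a = 1 / real (2 * k + 1) in
        3 * local_estimator \<xi> n B W w a 0 P1 + local_estimator \<xi> n B W w a 0 P2
          - 2 * local_estimator \<xi> n B W w a 0 P3 = 0"
      using rel by eventually_elim (simp add: Let_def)
    then show "\<not> multigrid_convergent \<xi> n B W w convex_polytopes"
      unfolding multigrid_convergent_def
      using no_limit[of "\<lambda>a. local_estimator \<xi> n B W w a 0"] P by blast
  qed
qed

end
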